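(* Let $n,m$ be relatively prime positive integers with $n\mid (m-1)^2$, let $l=\gcd(n,m-1)$, and let $p(x,y)=\frac n2\left(x-\frac{m-1}{n}y\right)^2+dx+ey+f$ (with $d,e,f\in\mathbb{R}$) be a packing polynomial on $S(n/m)$. Then for some $k\in\mathbb{N}$ either 1. $p$ is an ascending $k$-stair polynomial, $k\equiv \frac{m-1}{l} \pmod{\frac nl}$, and $$p(x,y)=\frac n2\left(x-\frac{m-1}{n}y\right)^2+\left(1-\frac{kl}{2}\right)x+\frac{2(1-m)+kl(m+1)}{2n}y+f,$$ or 2. $p$ is a descending $k$-stair polynomial, $k\equiv -\frac{m-1}{l} \pmod{\frac nl}$, and $$p(x,y)=\frac n2\left(x-\frac{m-1}{n}y\right)^2+\left(1+\frac{kl}{2}\right)x+\frac{2(1-m)-kl(m+1)}{2n}y+f.$$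
   Context: $\mathbb{N}=\{0,1,2,\dots\}$. For real $\alpha\ge 0$, $S(\alpha)=\{(x,y)\in\mathbb{R}^2 : x,y\ge 0,\ y\le \alpha x\}$ and $I(\alpha)=S(\alpha)\cap\mathbb{Z}^2$. A real polynomial $p(x,y)$ is a packing polynomial on $S(\alpha)$ if $p|_{I(\alpha)}$ is a bijection from $I(\alpha)$ to $\mathbb{N}$. For coprime positive integers $n,m$ and $l=\gcd(n,m-1)$, the $c$-th staircase ($c\in\mathbb{N}$) of $I(n/m)$ is the segment of points $(x,y)\in S(n/m)$ with $nx-(m-1)y=cl$ (for $m\ne 1$: $y=\frac{n}{m-1}x-c\frac{l}{m-1}$). A stair is a point with integer coordinates on a staircase. Two distinct stairs $r,s$ are consecutive if they lie on the same staircase and there is no other stair on the segment from $r$ to $s$. For $k\in\mathbb{N}$, a quadratic polynomial $p$ with homogeneous quadratic part $\frac n2\left(x-\frac{m-1}{n}y\right)^2$ and $p(\mathbb{Z}^2)\subseteq\mathbb{Z}$ is a $k$-stair polynomial on $S(n/m)$ if $p(r)-p(s)=\pm k$ for any two consecutive stairs $r,s$. It is ascending if $p(s)-p(r)=k$ whenever $r,s$ are consecutive stairs with $|r|<|s|$ (Euclidean norm), and descending if $p(s)-p(r)=-k$ for all such $r,s$. *)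

theory Defs
  imports "HOL-Analysis.Analysis" "HOL-Number_Theory.Cong"
begin

definition sector :: "real \<Rightarrow> (real \<times> real) set" where
  "sector \<alpha> = {(x, y). 0 \<le> x \<and> 0 \<le> y \<and> y \<le> \<alpha> * x}"

definition lattice_sector :: "real \<Rightarrow> (real \<times> real) set" where
  "lattice_sector \<alpha> = sector \<alpha> \<inter> (\<int> \<times> \<int>)"

text \<open>Real polynomials in two variables are represented by their polynomial functions
  on \<open>real \<times> real\<close>.\<close>

definition packing_polynomial :: "real \<Rightarrow> (real \<times> real \<Rightarrow> real) \<Rightarrow> bool" where
  "packing_polynomial \<alpha> p \<longleftrightarrow>
     real_polynomial_function p \<and> bij_betw p (lattice_sector \<alpha>) \<nat>"

text \<open>In the definitions below \<open>n\<close> and \<open>m\<close> are meant to be positive, so that the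
  subtraction \<open>m - 1\<close> on the naturals is not truncated. For \<open>m = 1\<close> the gcd is \<open>n\<close> and the
  staircases are vertical.\<close>

definition staircase :: "nat \<Rightarrow> nat \<Rightarrow> nat \<Rightarrow> (real \<times> real) set" where
  "staircase n m c = {(x, y) \<in> sector (real n / real m).
     real n * x - (real m - 1) * y = real c * real (gcd n (m - 1))}"

definition stairs :: "nat \<Rightarrow> nat \<Rightarrow> (real \<times> real) set" where
  "stairs n m = (\<Union>c. staircase n m c) \<inter> (\<int> \<times> \<int>)"

definition consecutive_stairs :: "nat \<Rightarrow> nat \<Rightarrow> real \<times> real \<Rightarrow> real \<times> real \<Rightarrow> bool" where
  "consecutive_stairs n m r s \<longleftrightarrow>
     r \<in> stairs n m \<and> s \<in> stairs n m \<and> r \<noteq> s \<and>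
     (\<exists>c. r \<in> staircase n m c \<and> s \<in> staircase n m c) \<and>
     closed_segment r s \<inter> stairs n m = {r, s}"

definition quadratic_part :: "nat \<Rightarrow> nat \<Rightarrow> real \<Rightarrow> real \<Rightarrow> real" where
  "quadratic_part n m x y = real n / 2 * (x - (real m - 1) / real n * y)\<^sup>2"

definition stair_polynomial :: "nat \<Rightarrow> nat \<Rightarrow> nat \<Rightarrow> (real \<times> real \<Rightarrow> real) \<Rightarrow> bool" where
  "stair_polynomial n m k p \<longleftrightarrow>
     (\<exists>d e f. \<forall>x y. p (x, y) = quadratic_part n m x y + d * x + e * y + f) \<and>
     p ` (\<int> \<times> \<int>) \<subseteq> \<int> \<and>
     (\<forall>r s. consecutive_stairs n m r s \<longrightarrow> p r - p s = real k \<or> p r - p s = - real k)"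

text \<open>The norm on \<open>real \<times> real\<close> is the Euclidean one.\<close>

definition ascending_stair_polynomial ::
    "nat \<Rightarrow> nat \<Rightarrow> nat \<Rightarrow> (real \<times> real \<Rightarrow> real) \<Rightarrow> bool" where
  "ascending_stair_polynomial n m k p \<longleftrightarrow>
     stair_polynomial n m k p \<and>
     (\<forall>r s. consecutive_stairs n m r s \<and> norm r < norm s \<longrightarrow> p s - p r = real k)"

definition descending_stair_polynomial ::
    "nat \<Rightarrow> nat \<Rightarrow> nat \<Rightarrow> (real \<times> real \<Rightarrow> real) \<Rightarrow> bool" where
  "descending_stair_polynomial n m k p \<longleftrightarrow>
     stair_polynomial n m k p \<and>
     (\<forall>r s. consecutive_stairs n m r s \<and> norm r < norm s \<longrightarrow> p s - p r = - real k)"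

end

theory Submission
  imports Defs
begin

text \<open>Write \<open>a = n / l\<close>, \<open>b = (m - 1) / l\<close> and \<open>t = l / a\<close>; the last is an integer because
  \<open>n\<close> divides \<open>(m - 1)\<^sup>2\<close>. In terms of the staircase number \<open>c = a x - b y\<close> the quadratic part is
  \<open>t c\<^sup>2 / 2\<close>, the sector is \<open>0 \<le> y \<le> a t c\<close>, and consecutive stairs differ by \<open>(b, a)\<close>, along
  which \<open>p\<close> has a constant increment \<open>K\<close>. The lattice point that extends staircase \<open>c\<close> by one step
  past the upper edge of the sector has, for large \<open>c\<close>, a natural value, so it shares it with a
  point of the sector; by injectivity this is the first stair of a staircase, and comparing the
  quadratic growth shows that its number is \<open>c + K\<close>. With \<open>y'\<close> the ordinate of that first stair
  and \<open>a t c + w\<close> that of the extending point, this reads \<open>d + a t K / 2 = w - y'\<close>, where \<open>0 \<le> y' < a\<close>.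
  Two families of staircases, with \<open>w = a\<close> and with \<open>w = 1\<close>, bound the left-hand side by \<open>1\<close> from
  below and from above. Hence it equals \<open>1\<close>, and in the first family \<open>y' = a - 1\<close>, which is the
  congruence for \<open>K\<close>. The sign of \<open>K\<close> decides between ascending and descending.\<close>

section \<open>Integrality and growth of real quadratics\<close>

text \<open>The third difference of a quadratic along a line vanishes, so integrality at three
  equally spaced points carries over to the point one step before them.\<close>

lemma third_difference_Ints:
  fixes q :: "int \<Rightarrow> int \<Rightarrow> real"
  assumes q: "\<And>x y. q x y = \<alpha> * (u * of_int x + v * of_int y)\<^sup>2 + d * of_int x + e * of_int y + f"
    and "q (x + h) (y + k) \<in> \<int>" "q (x + 2 * h) (y + 2 * k) \<in> \<int>" "q (x + 3 * h) (y + 3 * k) \<in> \<int>"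
  shows "q x y \<in> \<int>"
proof -
  have "q x y = 3 * q (x + h) (y + k) - 3 * q (x + 2 * h) (y + 2 * k) + q (x + 3 * h) (y + 3 * k)"
    unfolding q by (simp add: power2_eq_square algebra_simps)
  with assms(2-4) show ?thesis by simp
qed

text \<open>Near \<open>c\<close>, moving the argument by one unit changes the parabola by about
  \<open>t * c\<close>. For large \<open>c\<close> this exceeds the tolerance
  \<open>\<bar>K\<bar>\<close>, which leaves room for only one \<open>c'\<close>.\<close>

lemma parabola_step_eq:
  fixes t A :: real and K :: int
  assumes "t > 0"
  shows "\<exists>C::real. \<forall>c c'. of_int c \<ge> C \<longrightarrow> c' \<ge> 0 \<longrightarrow>
    \<bar>t / 2 * (of_int c')\<^sup>2 + A * of_int c' - (t / 2 * (of_int c)\<^sup>2 + A * of_int c + of_int K * t * of_int c)\<bar> \<le> \<bar>of_int K\<bar>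
    \<longrightarrow> c' = c + K"
proof -
  define k where "k = real_of_int K"
  define B where "B = t / 2 * k\<^sup>2 + A * k"
  \<comment> \<open>The first bound rules out \<open>c' > c + K\<close>, the other two rule out
    \<open>c' < c + K\<close>.\<close>
  define C where "C = Max {(\<bar>k\<bar> + A\<^sup>2 / (2 * t) + 1) / t, (\<bar>k\<bar> + B + 1 - t * k / 2 - A) * 2 / t, (- t * k / 2 - A) * 2 / t}"
  show ?thesis
  proof (intro exI allI impI)
    fix c c' :: int
    assume cC: "of_int c \<ge> C" and c': "c' \<ge> 0" and
      bd: "\<bar>t / 2 * (of_int c')\<^sup>2 + A * of_int c' - (t / 2 * (of_int c)\<^sup>2 + A * of_int c + of_int K * t * of_int c)\<bar> \<le> \<bar>of_int K\<bar>"
    define z where "z = real_of_int c"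
    have z: "(\<bar>k\<bar> + A\<^sup>2 / (2 * t) + 1) / t \<le> z" "(\<bar>k\<bar> + B + 1 - t * k / 2 - A) * 2 / t \<le> z"
        "(- t * k / 2 - A) * 2 / t \<le> z"
      using cC unfolding C_def z_def by auto
    have z1: "\<bar>k\<bar> + A\<^sup>2 / (2 * t) + 1 \<le> t * z" and z2: "\<bar>k\<bar> + B + 1 \<le> t * z / 2 + t * k / 2 + A"
      and z3: "0 \<le> t * z / 2 + t * k / 2 + A"
      using z \<open>t > 0\<close> by (simp_all add: field_simps)
    define g where "g = real_of_int (K - (c' - c))"
    have z': "real_of_int c' = z + k - g" unfolding g_def z_def k_def by simp
    have eq: "t / 2 * (of_int c')\<^sup>2 + A * of_int c' - (t / 2 * (of_int c)\<^sup>2 + A * of_int c + of_int K * t * of_int c)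
        = - g * t * z + t / 2 * (k - g)\<^sup>2 + A * (k - g)"
      unfolding z' unfolding z_def[symmetric] k_def[symmetric] by (simp add: power2_eq_square field_simps)
    have bd': "\<bar>- g * t * z + t / 2 * (k - g)\<^sup>2 + A * (k - g)\<bar> \<le> \<bar>k\<bar>"
      using bd unfolding eq k_def .
    have "\<not> K - (c' - c) \<le> -1"
    proof
      assume "K - (c' - c) \<le> -1"
      then have g: "g \<le> -1" unfolding g_def by linarith
      have "0 \<le> t / 2 * (k - g + A / t)\<^sup>2" using \<open>t > 0\<close> by simp
      also have "\<dots> = t / 2 * (k - g)\<^sup>2 + A * (k - g) + A\<^sup>2 / (2 * t)"
        using \<open>t > 0\<close> by (simp add: power2_eq_square field_simps)
      finally have 1: "t / 2 * (k - g)\<^sup>2 + A * (k - g) \<ge> - (A\<^sup>2 / (2 * t))" by linarith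
      have tz: "t * z \<ge> 0" by (rule order_trans[OF _ z1]) (use \<open>t > 0\<close> in simp)
      have "1 * (t * z) \<le> - g * (t * z)" by (rule mult_right_mono) (use g tz in auto)
      then show False using bd' 1 z1 by (simp add: algebra_simps)
    qed
    moreover have "\<not> K - (c' - c) \<ge> 1"
    proof
      assume "K - (c' - c) \<ge> 1"
      then have g: "g \<ge> 1" unfolding g_def by linarith
      \<comment> \<open>Here \<open>c' \<ge> 0\<close> excludes the mirror branch of the parabola:
        it limits \<open>g\<close>, so the term \<open>t / 2 * g * g\<close> eats up only about half
        of \<open>g * t * z\<close>.\<close>
      have gz: "g \<le> z + k" using c' z' by linarith
      have "t / 2 * g * g \<le> t / 2 * g * (z + k)"
        by (rule mult_left_mono) (use gz g \<open>t > 0\<close> in auto)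
      moreover have "1 * (t * z / 2 + t * k / 2 + A) \<le> g * (t * z / 2 + t * k / 2 + A)"
        by (rule mult_right_mono) (use g z3 in auto)
      ultimately have "- g * t * z + t / 2 * (k - g)\<^sup>2 + A * (k - g) \<le> - (t * z / 2 + t * k / 2 + A) + B"
        unfolding B_def by (simp add: power2_eq_square algebra_simps)
      then show False using bd' z2 by linarith
    qed
    ultimately show "c' = c + K" by linarith
  qed
qed

lemma parabola_nonneg:
  fixes t A B :: real
  assumes "t > 0"
  shows "\<exists>C. \<forall>z\<ge>C. t / 2 * z\<^sup>2 + A * z + B \<ge> 0"
proof (intro exI allI impI)
  fix z :: real
  assume z: "max 1 ((\<bar>A\<bar> + \<bar>B\<bar>) * 2 / t) \<le> z"
  then have z1: "1 \<le> z" and "\<bar>A\<bar> + \<bar>B\<bar> \<le> t / 2 * z"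
    using \<open>t > 0\<close> by (simp_all add: field_simps)
  then have "(\<bar>A\<bar> + \<bar>B\<bar>) * z \<le> t / 2 * z * z" by (intro mult_right_mono) auto
  moreover have "\<bar>B\<bar> * 1 \<le> \<bar>B\<bar> * z" using z1 by (intro mult_left_mono) auto
  moreover have "\<bar>A * z\<bar> = \<bar>A\<bar> * z" using z1 by (simp add: abs_mult)
  ultimately show "t / 2 * z\<^sup>2 + A * z + B \<ge> 0"
    by (simp add: power2_eq_square algebra_simps)
qed

section \<open>The packing polynomial in staircase coordinates\<close>

text \<open>\<open>q\<close> is the polynomial on integer points and \<open>I\<close> the set of
  integer points of the sector. With \<open>n = a * a * t\<close> and
  \<open>m = a * b * t + 1\<close>, clearing denominators in \<open>y \<le> n / m * x\<close> gives
  the upper bound in \<open>mem_I\<close>; together with \<open>0 \<le> y\<close> it forces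
  \<open>0 \<le> x\<close>.\<close>

locale packing_form =
  fixes a b t :: int and d e f :: real and q :: "int \<Rightarrow> int \<Rightarrow> real" and I :: "(int \<times> int) set"
  assumes a: "a > 0" and b: "b \<ge> 0" and t: "t > 0"
    and q: "\<And>x y. q x y = of_int t / 2 * (of_int (a * x - b * y))\<^sup>2 + d * of_int x + e * of_int y + f"
    and mem_I: "\<And>x y. (x, y) \<in> I \<longleftrightarrow> 0 \<le> y \<and> y \<le> a * t * (a * x - b * y)"
    and q_bij: "bij_betw (case_prod q) I \<nat>"
begin

definition K :: real where "K = d * of_int b + e * of_int a"

lemma q_shift: "q (x + i * b) (y + i * a) = q x y + of_int i * K"
  unfolding q K_def by (simp add: power2_eq_square algebra_simps)

lemma q_stair:
  "q x y = of_int t / 2 * (of_int (a * x - b * y))\<^sup>2 + d / of_int a * of_int (a * x - b * y)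
    + K / of_int a * of_int y + f"
  unfolding q K_def using a by (simp add: field_simps)

lemma q_in_Nats: "(x, y) \<in> I \<Longrightarrow> q x y \<in> \<nat>"
  using q_bij by (force simp: bij_betw_def)

lemma q_inj: "(x, y) \<in> I \<Longrightarrow> (x', y') \<in> I \<Longrightarrow> q x y = q x' y' \<Longrightarrow> x = x' \<and> y = y'"
  using q_bij by (force simp: bij_betw_def inj_on_def)

lemma q_surj: "z \<in> \<nat> \<Longrightarrow> \<exists>x y. (x, y) \<in> I \<and> q x y = z"
  using q_bij by (force simp: bij_betw_def)

text \<open>From any lattice point a suitable lattice direction leads into the sector, where the
  values are natural; the third difference brings integrality back.\<close>

lemma q_in_Ints: "q x y \<in> \<int>"
proof -
  define w where "w = a * t * (a * x - b * y)"
  define s where "s = \<bar>y\<bar> + \<bar>w\<bar>"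
  \<comment> \<open>Each step raises the staircase number by \<open>2 * a * s\<close>, hence the
    upper bound at least twice as much as the ordinate; \<open>s\<close> is large enough to absorb
    the starting offsets \<open>y\<close> and \<open>w\<close>.\<close>
  have mem: "q (x + j * (s * (b + 2))) (y + j * (s * a)) \<in> \<int>" if "j \<ge> 1" for j
  proof -
    have s0: "s \<ge> 0" unfolding s_def by simp
    have "s * 1 \<le> s * (j * a)"
      using s0 that a by (intro mult_left_mono) (simp_all add: int_one_le_iff_zero_less)
    then have sja: "s \<le> j * (s * a)" by (simp add: algebra_simps)
    have "1 \<le> a * t" using a t by (simp add: int_one_le_iff_zero_less)
    then have "(j * (s * a)) * 1 \<le> (j * (s * a)) * (a * t)"
      using that s0 a by (intro mult_left_mono) auto
    moreover have "a * t * (a * (x + j * (s * (b + 2))) - b * (y + j * (s * a))) = w + 2 * (j * (s * a) * (a * t))"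
      unfolding w_def by (simp add: algebra_simps)
    ultimately have "(x + j * (s * (b + 2)), y + j * (s * a)) \<in> I"
      unfolding mem_I using sja unfolding s_def by linarith
    then show ?thesis using q_in_Nats Nats_subset_Ints by blast
  qed
  have q': "q x y = of_int t / 2 * (of_int a * of_int x + (- of_int b) * of_int y)\<^sup>2 + d * of_int x + e * of_int y + f" for x y
    unfolding q by simp
  show ?thesis
    by (rule third_difference_Ints[OF q', of x "s * (b + 2)" y "s * a"])
      (use mem[of 1] mem[of 2] mem[of 3] in simp_all)
qed

lemma K_Ints: "K \<in> \<int>"
  using q_shift[of 0 1 0] q_in_Ints[of 0 0] q_in_Ints[of b a]
  by (simp add: eq_diff_eq[symmetric] add.commute)

text \<open>If \<open>K\<close> were zero, \<open>q\<close> would be constant along each staircase;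
  \<open>(1, 0)\<close> and the top stair of its staircase would contradict injectivity.\<close>

lemma K_nonzero: "K \<noteq> 0"
proof
  assume "K = 0"
  with q_shift[of 1 "a * t" 0] have "q (1 + a * t * b) (a * t * a) = q 1 0" by simp
  moreover have "(1 + a * t * b, a * t * a) \<in> I" "(1, 0) \<in> I"
    unfolding mem_I using a b t by (simp_all add: algebra_simps)
  ultimately show False using q_inj[of "1 + a * t * b" "a * t * a" 1 0] a t by simp
qed

section \<open>Points just past the upper edge\<close>

lemma overshoot_value:
  "\<exists>C::real. \<forall>x y. of_int (a * x - b * y) \<ge> C \<longrightarrow> a * t * (a * x - b * y) < y \<longrightarrow> y \<le> a * t * (a * x - b * y) + a
    \<longrightarrow> (\<exists>x' y'. 0 \<le> y' \<and> y' < a \<and> of_int (a * x' - b * y') = of_int (a * x - b * y) + K \<and>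
        q x' y' = q x y)"
proof -
  obtain k where k: "K = of_int k" using K_Ints by (auto elim: Ints_cases)
  have tr: "(of_int t :: real) > 0" and ar: "(of_int a :: real) > 0" using t a by simp_all
  define A where "A = d / of_int a"
  obtain C1 :: real where C1: "\<And>c c'. of_int c \<ge> C1 \<Longrightarrow> c' \<ge> 0 \<Longrightarrow>
    \<bar>of_int t / 2 * (of_int c')\<^sup>2 + A * of_int c' - (of_int t / 2 * (of_int c)\<^sup>2 + A * of_int c + of_int k * of_int t * of_int c)\<bar> \<le> \<bar>of_int k\<bar>
    \<Longrightarrow> c' = c + k"
    using parabola_step_eq[OF tr, of A k] by blast
  obtain C2 where C2: "\<And>z. z \<ge> C2 \<Longrightarrow> of_int t / 2 * z\<^sup>2 + (A + K * of_int t) * z + (f - \<bar>K\<bar>) \<ge> 0"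
    using parabola_nonneg[OF tr] by blast
  show ?thesis
  \<comment> \<open>\<open>C1\<close> pins down the staircase number, \<open>C2\<close> makes
    \<open>q x y\<close> nonnegative, and \<open>1\<close> keeps the ordinate nonnegative after one
    step back from the overshooting point.\<close>
  proof (intro exI[of _ "Max {C1, C2, 1}"] allI impI)
    fix x y :: int
    define c where "c = a * x - b * y"
    define w where "w = y - a * t * c"
    assume "of_int (a * x - b * y) \<ge> Max {C1, C2, 1}"
      and y1: "a * t * (a * x - b * y) < y" and y2: "y \<le> a * t * (a * x - b * y) + a"
    then have c1: "of_int c \<ge> C1" and c2: "of_int c \<ge> C2" and c0: "c \<ge> 1"
      unfolding c_def[symmetric] by (simp_all del: of_int_diff of_int_mult)
    have w: "0 < w" "w \<le> a" using y1 y2 unfolding w_def c_def by auto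
    have qxy: "q x y = of_int t / 2 * (of_int c)\<^sup>2 + (A + K * of_int t) * of_int c + K * (of_int w / of_int a) + f"
      unfolding q_stair A_def w_def c_def[symmetric] using ar by (simp add: field_simps)
    have "\<bar>K * (of_int w / of_int a)\<bar> = \<bar>K\<bar> * (of_int w / of_int a)"
      using w ar by (simp add: abs_mult)
    also have "\<dots> \<le> \<bar>K\<bar> * 1" using w ar by (intro mult_left_mono) auto
    finally have "q x y \<ge> 0" using C2[OF c2] unfolding qxy by linarith
    then have "q x y \<in> \<nat>" using q_in_Ints[of x y] by (simp add: Nats_altdef2)
    then obtain x' y' where mem: "(x', y') \<in> I" and eq: "q x' y' = q x y"
      using q_surj by blast
    have y0: "0 \<le> y'" and y'l: "y' \<le> a * t * (a * x' - b * y')" using mem unfolding mem_I by auto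
    \<comment> \<open>Otherwise both points, moved back by \<open>(b, a)\<close>, lie in
      \<open>I\<close> and still share a value. Injectivity then identifies them, although
      \<open>(x, y)\<close> lies outside \<open>I\<close>.\<close>
    have "y' < a"
    proof (rule ccontr)
      assume "\<not> y' < a"
      then have "(x' - b, y' - a) \<in> I" using y'l a unfolding mem_I by (simp add: algebra_simps)
      moreover have "(x - b, y - a) \<in> I"
      proof -
        have "a * 1 \<le> a * (t * c)" using a t c0 by (intro mult_left_mono) (simp_all add: int_one_le_iff_zero_less)
        then show ?thesis using w unfolding mem_I c_def w_def by (simp add: algebra_simps)
      qed
      ultimately have "x' - b = x - b \<and> y' - a = y - a"
        using q_inj q_shift[of x' "-1" y'] q_shift[of x "-1" y] eq by simp
      then show False using y1 y'l by simp
    qed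
    define c' where "c' = a * x' - b * y'"
    have "a * t * c' \<ge> 0" using y0 y'l unfolding c'_def by linarith
    moreover have "a * t > 0" using a t by simp
    ultimately have c'0: "c' \<ge> 0" using zero_le_mult_iff[of "a * t" c'] by linarith
    \<comment> \<open>Both \<open>w\<close> and \<open>y'\<close> lie between \<open>0\<close> and
      \<open>a\<close>, so the right-hand side is at most \<open>\<bar>K\<bar>\<close> in absolute
      value, as the growth comparison requires.\<close>
    have "of_int t / 2 * (of_int c')\<^sup>2 + A * of_int c' - (of_int t / 2 * (of_int c)\<^sup>2 + A * of_int c + of_int k * of_int t * of_int c)
        = K * (of_int (w - y') / of_int a)"
      using eq unfolding qxy unfolding q_stair c'_def[symmetric] A_def[symmetric] k[symmetric]
      by (simp add: diff_divide_distrib algebra_simps)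
    moreover have "\<bar>K * (of_int (w - y') / of_int a)\<bar> \<le> \<bar>K\<bar> * 1"
      unfolding abs_mult using w y0 \<open>y' < a\<close> ar by (intro mult_left_mono) auto
    ultimately have "c' = c + k" using C1[OF c1 c'0] k by simp
    then have "of_int (a * x' - b * y') = of_int (a * x - b * y) + K"
      unfolding c'_def c_def k by (metis of_int_add)
    then show "\<exists>x' y'. 0 \<le> y' \<and> y' < a \<and> of_int (a * x' - b * y') = of_int (a * x - b * y) + K \<and> q x' y' = q x y"
      using y0 \<open>y' < a\<close> eq by blast
  qed
qed

lemma overshoot_equation:
  "\<exists>C::real. \<forall>x y w. of_int (a * x - b * y) \<ge> C \<longrightarrow> y = a * t * (a * x - b * y) + w \<longrightarrow> 0 < w \<longrightarrow> w \<le> a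
    \<longrightarrow> (\<exists>x' y'. 0 \<le> y' \<and> y' < a \<and> of_int (a * x' - b * y') = of_int (a * x - b * y) + K \<and>
        of_int (w - y') = d + K * of_int (a * t) / 2)"
proof -
  obtain C :: real where C: "\<And>x y. of_int (a * x - b * y) \<ge> C \<Longrightarrow> a * t * (a * x - b * y) < y \<Longrightarrow>
      y \<le> a * t * (a * x - b * y) + a \<Longrightarrow>
      \<exists>x' y'. 0 \<le> y' \<and> y' < a \<and> of_int (a * x' - b * y') = of_int (a * x - b * y) + K \<and> q x' y' = q x y"
    using overshoot_value by blast
  show ?thesis
  proof (intro exI[of _ C] allI impI)
    fix x y w
    assume "C \<le> of_int (a * x - b * y)" and y: "y = a * t * (a * x - b * y) + w" and "0 < w" "w \<le> a"
    then obtain x' y' where 1: "0 \<le> y'" "y' < a" and c': "of_int (a * x' - b * y') = of_int (a * x - b * y) + K"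
      and eq: "q x' y' = q x y"
      using C[of x y] by auto
    define c where "c = real_of_int (a * x - b * y)"
    have ar: "(of_int a :: real) > 0" using a by simp
    have yr: "real_of_int y = of_int a * of_int t * c + of_int w"
      unfolding c_def by (subst y) simp
    \<comment> \<open>Substituting \<open>c + K\<close> for the new staircase number cancels every
      term in \<open>c\<close>, and what remains has the factor \<open>K\<close>, which is
      nonzero.\<close>
    have "K * (of_int t * K / 2 + d / of_int a + (of_int y' - of_int w) / of_int a) = q x' y' - q x y"
      unfolding q_stair c' c_def[symmetric] unfolding yr using ar by (simp add: field_simps power2_eq_square)
    with eq have "of_int t * K / 2 + d / of_int a + (of_int y' - of_int w) / of_int a = 0"
      using K_nonzero by simp
    then have "of_int a * (of_int t * K / 2 + d / of_int a + (of_int y' - of_int w) / of_int a) = 0" by simp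
    then have "of_int (w - y') = d + K * of_int (a * t) / 2"
      using ar by (simp add: distrib_left mult_ac)
    with 1 c' show "\<exists>x' y'. 0 \<le> y' \<and> y' < a \<and> of_int (a * x' - b * y') = of_int (a * x - b * y) + K \<and>
        of_int (w - y') = d + K * of_int (a * t) / 2" by blast
  qed
qed

text \<open>The quantity \<open>d + K * of_int (a * t) / 2\<close> equals
  \<open>a - y1 \<ge> 1\<close> for an overshoot by \<open>a\<close> and
  \<open>1 - y2 \<le> 1\<close> for an overshoot by \<open>1\<close>, so both inequalities are
  equalities.\<close>

lemma step_determines:
  assumes k: "K = of_int k"
  shows "d = 1 - K * of_int (a * t) / 2" and "[k = b] (mod a)"
proof -
  obtain C :: real where C: "\<And>x y w. of_int (a * x - b * y) \<ge> C \<Longrightarrow> y = a * t * (a * x - b * y) + w \<Longrightarrow>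
      0 < w \<Longrightarrow> w \<le> a \<Longrightarrow>
      \<exists>x' y'. 0 \<le> y' \<and> y' < a \<and> of_int (a * x' - b * y') = of_int (a * x - b * y) + K \<and>
        of_int (w - y') = d + K * of_int (a * t) / 2"
    using overshoot_equation by blast
  \<comment> \<open>Chosen so that the two staircase numbers \<open>a * i\<close> and
    \<open>a * i - b\<close> both reach \<open>C\<close>.\<close>
  define i where "i = \<bar>\<lceil>C\<rceil>\<bar> + b"
  have "1 * i \<le> a * i" using a b unfolding i_def by (intro mult_right_mono) auto
  moreover have "\<lceil>C\<rceil> + b \<le> i" unfolding i_def by linarith
  ultimately have "\<lceil>C\<rceil> \<le> a * i - b" by linarith
  moreover from this have "\<lceil>C\<rceil> \<le> a * i" using b by linarith
  ultimately have ai: "C \<le> of_int (a * i - b)" "C \<le> of_int (a * i)" by (simp_all only: ceiling_le_iff)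
  \<comment> \<open>From \<open>(i, 0)\<close>, \<open>a * t * i\<close> steps \<open>(b, a)\<close>
    end on the upper edge; one more overshoots by \<open>a\<close>.\<close>
  have c1: "a * (i * (a * b * t + 1) + b) - b * (i * (a * a * t) + a) = a * i"
    by (simp add: algebra_simps)
  \<comment> \<open>From \<open>(i, 1)\<close>, on staircase \<open>a * i - b\<close>, taking
    \<open>t * (a * i - b)\<close> steps \<open>(b, a)\<close> ends at height \<open>1\<close> above
    the edge.\<close>
  have c2: "a * (i * (a * b * t + 1) - b * b * t) - b * (a * t * (a * i - b) + 1) = a * i - b"
    by (simp add: algebra_simps)
  obtain x1 y1 where 1: "0 \<le> y1" "y1 < a" "of_int (a * x1 - b * y1) = of_int (a * i) + K"
      "of_int (a - y1) = d + K * of_int (a * t) / 2"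
    using C[of "i * (a * b * t + 1) + b" "i * (a * a * t) + a" a, unfolded c1] ai a
    by (auto simp: algebra_simps)
  obtain x2 y2 where 2: "0 \<le> y2" "y2 < a"
      "of_int (1 - y2) = d + K * of_int (a * t) / 2"
    using C[of "i * (a * b * t + 1) - b * b * t" "a * t * (a * i - b) + 1" 1, unfolded c2] ai a
    by auto
  have "real_of_int (a - y1) = of_int (1 - y2)" using 1 2 by simp
  then have "a - y1 = 1 - y2" by (simp only: of_int_eq_iff)
  then have y: "y1 = a - 1" "y2 = 0" using 1 2 by auto
  then show "d = 1 - K * of_int (a * t) / 2" using 2 by simp
  have "real_of_int (a * x1 - b * y1) = of_int (a * i + k)" using 1 k by simp
  then have "a * x1 - b * y1 = a * i + k" by (simp only: of_int_eq_iff)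
  then have "k - b = a * (x1 - b - i)" unfolding y by (simp add: algebra_simps)
  then show "[k = b] (mod a)" by (simp add: cong_iff_dvd_diff)
qed

end

section \<open>The step between consecutive stairs\<close>

lemma convex_sector: "convex (sector \<alpha>)"
proof -
  have "sector \<alpha> = {z. inner (1, 0) z \<ge> 0} \<inter> {z. inner (0, 1) z \<ge> 0} \<inter> {z. inner (\<alpha>, -1) z \<ge> 0}"
    unfolding sector_def by auto
  then show ?thesis by (simp only: convex_Int convex_halfspace_ge)
qed

lemma convex_staircase: "convex (staircase n m c)"
proof -
  have "staircase n m c = sector (real n / real m) \<inter>
      {z. inner (real n, - (real m - 1)) z = real c * real (gcd n (m - 1))}"
    unfolding staircase_def by (auto simp: algebra_simps)
  then show ?thesis by (simp only: convex_Int convex_sector convex_hyperplane)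
qed

text \<open>Coprimality of \<open>n div l\<close> and \<open>(m - 1) div l\<close> makes
  \<open>s - r\<close> an integer multiple of \<open>v\<close>. By convexity the staircase contains
  the point one step \<open>v\<close> from \<open>r\<close> towards \<open>s\<close>; it is a stair
  on the segment, hence \<open>s\<close> itself.\<close>

lemma consecutive_stairs_step:
  assumes "n > 0" "m > 0" and l: "l = gcd n (m - 1)" and cs: "consecutive_stairs n m r s"
  defines "v \<equiv> (real ((m - 1) div l), real (n div l))"
  shows "s = r + v \<or> r = s + v"
proof -
  define a b where "a = int (n div l)" and "b = int ((m - 1) div l)"
  have l0: "l > 0" using assms by (simp add: gcd_pos_nat)
  have "n = l * (n div l)" "m - 1 = l * ((m - 1) div l)" unfolding l by simp_all
  then have "int n = int l * a" "int (m - 1) = int l * b" unfolding a_def b_def by (metis of_nat_mult)+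
  then have nr: "real n = real l * of_int a" and mr: "real m - 1 = real l * of_int b"
    using \<open>m > 0\<close> by (metis of_int_mult of_int_of_nat_eq, metis Suc_leI One_nat_def of_int_mult of_int_of_nat_eq of_nat_1 of_nat_diff)
  have a0: "a > 0" using \<open>int n = int l * a\<close> \<open>n > 0\<close> l0 by (metis mult_pos_pos of_nat_0_less_iff zero_less_mult_pos)
  have cop: "coprime a b"
    unfolding a_def b_def l using assms by (simp add: div_gcd_coprime)
  have v: "v = (of_int b, of_int a)" unfolding v_def a_def b_def by simp
  obtain c where rc: "r \<in> staircase n m c" and sc: "s \<in> staircase n m c" and rs: "r \<noteq> s"
    and seg: "closed_segment r s \<inter> stairs n m = {r, s}"
    and st: "r \<in> stairs n m" "s \<in> stairs n m"
    using cs unfolding consecutive_stairs_def by auto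
  obtain x1 y1 where r: "r = (real_of_int x1, real_of_int y1)"
    using st(1) unfolding stairs_def by (auto elim!: Ints_cases)
  obtain x2 y2 where s: "s = (real_of_int x2, real_of_int y2)"
    using st(2) unfolding stairs_def by (auto elim!: Ints_cases)
  have "real n * x1 - (real m - 1) * y1 = real n * x2 - (real m - 1) * y2"
    using rc sc unfolding r s staircase_def by simp
  then have "real l * (of_int a * of_int (x2 - x1)) = real l * (of_int b * of_int (y2 - y1))"
    unfolding nr mr by (simp add: algebra_simps)
  then have "real_of_int (a * (x2 - x1)) = of_int (b * (y2 - y1))"
    using l0 by simp
  then have E: "a * (x2 - x1) = b * (y2 - y1)" by (simp only: of_int_eq_iff)
  then have "a dvd b * (y2 - y1)" by (metis dvd_triv_left)
  then have "a dvd y2 - y1" using cop by (simp add: coprime_dvd_mult_right_iff)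
  then obtain i where y: "y2 = y1 + i * a" by (metis dvd_def mult.commute add_diff_cancel_left' diff_add_cancel add.commute)
  with E have "a * (x2 - x1) = a * (i * b)" by (simp add: mult_ac)
  then have x: "x2 = x1 + i * b" using a0 by simp
  have sr: "s = r + of_int i *\<^sub>R v" unfolding r s x y v by (simp add: algebra_simps)
  have i0: "i \<noteq> 0" using sr rs by auto
  define j where "j = sgn i"
  define u where "u = r + of_int j *\<^sub>R v"
  have iu: "real_of_int j = (1 / \<bar>real_of_int i\<bar>) * of_int i"
    using i0 unfolding j_def by (simp add: sgn_if)
  have useg: "u \<in> closed_segment r s"
    unfolding in_segment
  proof (intro exI conjI)
    show "u = (1 - 1 / \<bar>real_of_int i\<bar>) *\<^sub>R r + (1 / \<bar>real_of_int i\<bar>) *\<^sub>R s"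
      unfolding u_def iu unfolding sr by (simp add: algebra_simps)
    show "1 / \<bar>real_of_int i\<bar> \<le> 1" "0 \<le> 1 / \<bar>real_of_int i\<bar>"
      using i0 by (auto simp: divide_le_eq)
  qed
  then have "u \<in> staircase n m c"
    using convex_staircase rc sc by (meson closed_segment_subset subsetD)
  moreover have "u \<in> \<int> \<times> \<int>" unfolding u_def r v by simp
  ultimately have "u \<in> stairs n m" unfolding stairs_def by blast
  with seg useg have "u = r \<or> u = s" by blast
  moreover have "v \<noteq> 0" using a0 unfolding v by (simp add: zero_prod_def)
  moreover have "u - s = (of_int (j - i)) *\<^sub>R v" unfolding u_def sr by (simp add: algebra_simps)
  ultimately have "j = 0 \<or> j = i" unfolding u_def by auto
  then have "i = 1 \<or> i = -1" using i0 unfolding j_def by (auto simp: sgn_if split: if_splits)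
  then show ?thesis using sr by auto
qed

section \<open>Passage from the real sector to integer coordinates, and the two cases\<close>

theorem theorem2:
  fixes n m l :: nat and d e f :: real and p :: "real \<times> real \<Rightarrow> real"
  assumes "n > 0" and "m > 0" and "coprime n m"
    and "n dvd (m - 1)\<^sup>2"
    and "l = gcd n (m - 1)"
    and "\<And>x y. p (x, y) = real n / 2 * (x - (real m - 1) / real n * y)\<^sup>2 + d * x + e * y + f"
    and "packing_polynomial (real n / real m) p"
  shows "\<exists>k::nat.
    (ascending_stair_polynomial n m k p \<and>
     [int k = int ((m - 1) div l)] (mod int (n div l)) \<and>
     (\<forall>x y. p (x, y) = real n / 2 * (x - (real m - 1) / real n * y)\<^sup>2
        + (1 - real k * real l / 2) * x
        + (2 * (1 - real m) + real k * real l * (real m + 1)) / (2 * real n) * y + f)) \<or>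
    (descending_stair_polynomial n m k p \<and>
     [int k = - int ((m - 1) div l)] (mod int (n div l)) \<and>
     (\<forall>x y. p (x, y) = real n / 2 * (x - (real m - 1) / real n * y)\<^sup>2
        + (1 + real k * real l / 2) * x
        + (2 * (1 - real m) - real k * real l * (real m + 1)) / (2 * real n) * y + f))"
proof -
  note l = assms(5) and p = assms(6)
  define a b where "a = n div l" and "b = (m - 1) div l"
  define t where "t = l div a"
  have l0: "l > 0" using assms by (simp add: gcd_pos_nat)
  have nl: "n = l * a" and ml: "m - 1 = l * b" unfolding a_def b_def l by simp_all
  have a0: "a > 0" using nl \<open>n > 0\<close> by simp
  have cop: "coprime a b"
    unfolding a_def b_def l using assms(1) by (simp add: div_gcd_coprime)
  \<comment> \<open>This is where \<open>n dvd (m - 1)\<^sup>2\<close> enters: it yields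
    \<open>a dvd l\<close>, so the division defining \<open>t\<close> is exact.\<close>
  have "l * a dvd l * (b\<^sup>2 * l)"
    using \<open>n dvd (m - 1)\<^sup>2\<close> unfolding nl ml by (simp add: power2_eq_square algebra_simps)
  then have "a dvd b\<^sup>2 * l" using l0 by simp
  then have "a dvd l" using cop by (simp add: coprime_dvd_mult_right_iff)
  then have lt: "l = a * t" unfolding t_def by simp
  have t0: "t > 0" using l0 lt by simp
  have nr: "real n = real a * real a * real t" and lr: "real l = real a * real t"
    unfolding nl lt by simp_all
  have "real m - 1 = real (m - 1)" using \<open>m > 0\<close> by (simp add: of_nat_diff)
  then have mr: "real m = real a * real b * real t + 1" unfolding ml lt by (simp add: algebra_simps)
  define q where "q = (\<lambda>x y :: int. p (real_of_int x, real_of_int y))"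
  define I where "I = {(x, y). 0 \<le> y \<and> y \<le> int a * int t * (int a * x - int b * y)}"
  have mem: "(real_of_int x, real_of_int y) \<in> sector (real n / real m) \<longleftrightarrow> (x, y) \<in> I" for x y
  proof -
    have "real_of_int y \<le> real n / real m * real_of_int x \<longleftrightarrow> real_of_int y * real m \<le> real n * real_of_int x"
      using \<open>m > 0\<close> by (simp add: field_simps)
    also have "\<dots> \<longleftrightarrow> real_of_int y \<le> of_int (int a * int t * (int a * x - int b * y))"
      unfolding nr mr by (simp add: algebra_simps)
    finally have 1: "real_of_int y \<le> real n / real m * real_of_int x \<longleftrightarrow> y \<le> int a * int t * (int a * x - int b * y)"
      by (simp only: of_int_le_iff)
    have "0 \<le> real_of_int x" if "0 \<le> real_of_int y" "real_of_int y \<le> real n / real m * real_of_int x"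
    proof -
      have "0 \<le> real n / real m * real_of_int x" using that by linarith
      then show ?thesis using \<open>m > 0\<close> \<open>n > 0\<close> by (simp add: zero_le_mult_iff zero_le_divide_iff)
    qed
    with 1 show ?thesis unfolding sector_def I_def by auto
  qed
  have "bij_betw (map_prod real_of_int real_of_int) I (lattice_sector (real n / real m))"
    unfolding bij_betw_def
  proof
    show "inj_on (map_prod real_of_int real_of_int) I" by (auto simp: inj_on_def)
    show "map_prod real_of_int real_of_int ` I = lattice_sector (real n / real m)"
    proof
      show "map_prod real_of_int real_of_int ` I \<subseteq> lattice_sector (real n / real m)"
        using mem unfolding lattice_sector_def by auto
      show "lattice_sector (real n / real m) \<subseteq> map_prod real_of_int real_of_int ` I"
        unfolding lattice_sector_def using mem by (force elim!: Ints_cases)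
    qed
  qed
  then have "bij_betw (p \<circ> map_prod real_of_int real_of_int) I \<nat>"
    using assms(7) unfolding packing_polynomial_def by (meson bij_betw_trans)
  moreover have "p \<circ> map_prod real_of_int real_of_int = case_prod q"
    unfolding q_def by auto
  ultimately have bij: "bij_betw (case_prod q) I \<nat>" by simp
  interpret packing_form "int a" "int b" "int t" d e f q I
  proof
    show "q x y = of_int (int t) / 2 * (of_int (int a * x - int b * y))\<^sup>2 + d * of_int x + e * of_int y + f" for x y
      unfolding q_def p nr mr using a0 t0 by (simp add: field_simps power2_eq_square)
  qed (use a0 t0 bij in \<open>auto simp: I_def\<close>)
  obtain k where k: "K = of_int k" using K_Ints by (auto elim: Ints_cases)
  have d: "d = 1 - of_int k * real l / 2" and kb: "[k = int b] (mod int a)"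
    using step_determines[OF k] unfolding k lr by simp_all
  \<comment> \<open>With \<open>d\<close> known, the definition of \<open>K\<close> is a linear
    equation for \<open>e\<close>.\<close>
  have "e * real a = of_int k - d * real b" using k unfolding K_def by simp
  then have "e * (2 * real n) = 2 * real l * (of_int k - d * real b)"
    unfolding nr lr by (simp flip: \<open>e * real a = _\<close>)
  also have "\<dots> = 2 * (1 - real m) + of_int k * real l * (real m + 1)"
    unfolding d mr lr by (simp add: algebra_simps)
  finally have e: "e = (2 * (1 - real m) + of_int k * real l * (real m + 1)) / (2 * real n)"
    using \<open>n > 0\<close> by (simp add: field_simps)
  have p_step: "p (z + (real b, real a)) = p z + of_int k" for z
    unfolding k[symmetric] K_def p nr mr using a0 t0
    by (cases z) (simp add: p nr mr field_simps power2_eq_square)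
  have step: "s = r + (real b, real a) \<or> r = s + (real b, real a)" if "consecutive_stairs n m r s" for r s
    using consecutive_stairs_step[OF assms(1,2) l that] unfolding a_def b_def .
  \<comment> \<open>Coordinates in the sector are nonnegative, so adding \<open>(b, a)\<close>
    cannot decrease the norm; the norm thus orients the step.\<close>
  have step': "s = r + (real b, real a)" if "consecutive_stairs n m r s" "norm r < norm s" for r s
  proof (rule ccontr)
    assume "s \<noteq> r + (real b, real a)"
    then have rs: "r = s + (real b, real a)" using step that by blast
    obtain x y where s: "s = (x, y)" by (cases s)
    have "0 \<le> x" "0 \<le> y"
      using that(1) unfolding s consecutive_stairs_def stairs_def staircase_def sector_def by auto
    then have "norm s \<le> norm r"
      unfolding rs s by (auto simp: norm_Pair intro!: add_mono power_mono)
    with that show False by simp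
  qed
  have p_diff: "p s - p r = of_int k" if "consecutive_stairs n m r s" "norm r < norm s" for r s
    using step'[OF that] p_step[of r] by (simp del: split_paired_All)
  have stair: "stair_polynomial n m (nat \<bar>k\<bar>) p"
    unfolding stair_polynomial_def
  proof (intro conjI allI impI)
    show "\<exists>d e f. \<forall>x y. p (x, y) = quadratic_part n m x y + d * x + e * y + f"
      unfolding quadratic_part_def using p by blast
    show "p ` (\<int> \<times> \<int>) \<subseteq> \<int>" using q_in_Ints unfolding q_def by (auto elim!: Ints_cases)
    show "p r - p s = real (nat \<bar>k\<bar>) \<or> p r - p s = - real (nat \<bar>k\<bar>)" if "consecutive_stairs n m r s" for r s
      using step[OF that] p_step[of r] p_step[of s] by (auto simp del: split_paired_All)
  qed
  show ?thesis
  proof (cases "k \<ge> 0")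
    case True
    have "ascending_stair_polynomial n m (nat \<bar>k\<bar>) p"
      unfolding ascending_stair_polynomial_def using stair p_diff True by simp
    moreover have "[int (nat \<bar>k\<bar>) = int ((m - 1) div l)] (mod int (n div l))"
      using kb True unfolding a_def b_def by simp
    moreover have "real (nat \<bar>k\<bar>) = of_int k" using True by simp
    ultimately show ?thesis using p d e by (intro exI[of _ "nat \<bar>k\<bar>"]) simp
  next
    case False
    have "descending_stair_polynomial n m (nat \<bar>k\<bar>) p"
      unfolding descending_stair_polynomial_def using stair p_diff False by simp
    moreover have "[int (nat \<bar>k\<bar>) = - int ((m - 1) div l)] (mod int (n div l))"
      using kb False unfolding a_def b_def by (simp add: cong_minus_minus_iff)
    moreover have "real (nat \<bar>k\<bar>) = - of_int k" using False by simp
    ultimately show ?thesis using p d e by (intro exI[of _ "nat \<bar>k\<bar>"]) simp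
  qed
qed

end
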